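(* Let $\rho:[0,+\infty)\to\mathbb{R}$ satisfy: (AS1) $\rho(0)=0$, $\rho(s)<+\infty$ for all $s<+\infty$, and $0$ is the strict minimizer of $\rho$; (AS2) $\rho$ is increasing on $[0,+\infty)$. Let $0<\tau<+\infty$ and $\mathcal{T}(s)=\rho(\min(s,\tau))$ for $s\ge0$. Let $J=\{1,\dots,N\}$, $\emptyset\ne\Omega\subsetneq J$, let $\mathbf{1}_\Omega\in\mathbb{R}^N$ be the indicator function of $\Omega$, and let $J_1=\{i\in J:(\nabla_x\mathbf{1}_\Omega)_i\ne0\}$. Let $\alpha>0$, $\zeta>0$, let $A$ be a real $K\times N$ matrix with $A^{\mathsf T}A$ invertible, and let $\mu_{\min}>0$ be the minimal eigenvalue of $A^{\mathsf T}A$. Define $$E^\zeta(u)=\sum_{1\le i\le N}\mathcal{T}(|(\nabla_x u)_i|)+\frac{\alpha}{2}\|A(u-\zeta\mathbf{1}_\Omega)\|_{\mathbb{R}^K}^2,\qquad u\in\mathbb{R}^N.$$ If $$\zeta>\tau+\sqrt{\frac{4\mathcal{T}(\tau)}{\alpha\mu_{\min}}\,\#J_1},$$ then the global minimizer of $E^\zeta$ over $\mathbb{R}^N$ is $\zeta\mathbf{1}_\Omega$.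
   Context: "Increasing" is meant in the non-strict sense. $\nabla_x$ is the forward difference operator, $(\nabla_x u)_i=u_{i+1}-u_i$ for $1\le i\le N-1$, with a boundary condition at $i=N$, e.g. periodic ($(\nabla_x u)_N=u_1-u_N$) or Neumann ($(\nabla_x u)_N=0$). $\#$ denotes cardinality and $\|\cdot\|_{\mathbb{R}^K}$ is the Euclidean norm. *)

theory Defs
  imports
    "Jordan_Normal_Form.Spectral_Radius"
    "HOL-Analysis.L2_Norm"
    "HOL-Library.Indicator_Function"
begin

(* Vectors of R^N are elements of carrier_vec N, which are indexed from 0, so the index set
   {1,...,N} is represented by {0..<N} and the last index is N - 1. *)

datatype boundary_condition = Periodic | Neumann

definition forward_diff :: "boundary_condition \<Rightarrow> real vec \<Rightarrow> real vec" where
  "forward_diff bc u = vec (dim_vec u) (\<lambda>i.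
     if Suc i < dim_vec u then u $ Suc i - u $ i
     else (case bc of Periodic \<Rightarrow> u $ 0 - u $ i | Neumann \<Rightarrow> 0))"

definition indicator_vec :: "nat \<Rightarrow> nat set \<Rightarrow> real vec" where
  "indicator_vec N \<Omega> = vec N (indicator \<Omega>)"

(* The index set J_1 of the nonzero differences of the indicator function. *)
definition jump_set :: "boundary_condition \<Rightarrow> nat \<Rightarrow> nat set \<Rightarrow> nat set" where
  "jump_set bc N \<Omega> = {i \<in> {0..<N}. forward_diff bc (indicator_vec N \<Omega>) $ i \<noteq> 0}"

definition euclidean_norm :: "real vec \<Rightarrow> real" where
  "euclidean_norm v = L2_set (\<lambda>i. v $ i) {0..<dim_vec v}"

(* In the next three definitions \<rho> stands for a function on [0,\<infinity>): only its values at
   nonnegative arguments matter. Finiteness of \<rho> is expressed by its type. *)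

definition AS1 :: "(real \<Rightarrow> real) \<Rightarrow> bool" where
  "AS1 \<rho> \<longleftrightarrow> \<rho> 0 = 0 \<and> (\<forall>s>0. \<rho> 0 < \<rho> s)"

definition AS2 :: "(real \<Rightarrow> real) \<Rightarrow> bool" where
  "AS2 \<rho> \<longleftrightarrow> mono_on {0..} \<rho>"

definition truncation :: "(real \<Rightarrow> real) \<Rightarrow> real \<Rightarrow> real \<Rightarrow> real" where
  "truncation \<rho> \<tau> s = \<rho> (min s \<tau>)"

definition energy ::
  "boundary_condition \<Rightarrow> (real \<Rightarrow> real) \<Rightarrow> real \<Rightarrow> real \<Rightarrow> real mat \<Rightarrow> nat \<Rightarrow> nat set \<Rightarrow> real
    \<Rightarrow> real vec \<Rightarrow> real" where
  "energy bc \<rho> \<tau> \<alpha> A N \<Omega> \<zeta> u =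
     (\<Sum>i\<in>{0..<N}. truncation \<rho> \<tau> \<bar>forward_diff bc u $ i\<bar>)
     + \<alpha> / 2 * (euclidean_norm (A *\<^sub>v (u - \<zeta> \<cdot>\<^sub>v indicator_vec N \<Omega>)))\<^sup>2"

end

(* Write w for \<zeta> times the indicator and d = u - w. All jumps of w exceed \<tau>, so E(w) = #J_1 T(\<tau>).
   If E(u) \<le> E(w), the fidelity term and A^T A \<ge> \<mu>_min give |d|^2 \<le> 2 T(\<tau>) #J_1 / (\<alpha> \<mu>_min). Every
   forward difference of d is at most sqrt 2 |d|, hence at most \<zeta> - \<tau>, and the differences of u on
   J_1 are still at least \<tau>. Thus the regularizer of u is already at least E(w), so the fidelity
   term vanishes and d = 0. *)

theory Submission
  imports Defs
begin

section \<open>Coordinates of a real vector and its scalar square\<close>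

lemma sq_nth_le_scalar_prod_self:
  fixes v :: "real vec"
  assumes "v \<in> carrier_vec n" "i < n"
  shows "(v $ i)\<^sup>2 \<le> v \<bullet> v"
proof -
  have "(v $ i)\<^sup>2 \<le> (\<Sum>i\<in>{0..<n}. (v $ i)\<^sup>2)"
    by (rule member_le_sum) (use assms in auto)
  then show ?thesis
    using assms by (simp add: scalar_prod_def power2_eq_square)
qed

text \<open>Two distinct squared coordinates together stay below the scalar square, and (b - a)^2
  \<le> 2 (a^2 + b^2). The factor 2 reappears in the threshold for \<zeta>.\<close>

lemma sq_nth_diff_le_scalar_prod_self:
  fixes v :: "real vec"
  assumes "v \<in> carrier_vec n" "i < n" "j < n"
  shows "(v $ j - v $ i)\<^sup>2 \<le> 2 * (v \<bullet> v)"
\<comment> \<open>For \<open>i = j\<close> the set \<open>{i, j}\<close> collapses to one index.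
  This case occurs for the periodic difference of a vector of length 1.\<close>
proof (cases "i = j")
  case True
  with order_trans[OF zero_le_power2 sq_nth_le_scalar_prod_self[OF assms(1,2)]]
  show ?thesis by simp
next
  case False
  have "(\<Sum>k\<in>{i, j}. (v $ k)\<^sup>2) \<le> (\<Sum>k\<in>{0..<n}. (v $ k)\<^sup>2)"
    by (rule sum_mono2) (use assms in auto)
  then have *: "(v $ i)\<^sup>2 + (v $ j)\<^sup>2 \<le> v \<bullet> v"
    using assms False by (simp add: scalar_prod_def power2_eq_square)
  have "(v $ j - v $ i)\<^sup>2 \<le> 2 * ((v $ i)\<^sup>2 + (v $ j)\<^sup>2)"
    using zero_le_power2[of "v $ j + v $ i"] by (simp add: power2_sum power2_diff)
  also have "\<dots> \<le> 2 * (v \<bullet> v)"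
    using * by simp
  finally show ?thesis .
qed

lemma scalar_prod_self_eq_0_iff:
  fixes v :: "real vec"
  assumes "v \<in> carrier_vec n"
  shows "v \<bullet> v = 0 \<longleftrightarrow> v = 0\<^sub>v n"
proof
  assume "v \<bullet> v = 0"
  then have "v $ i = 0" if "i < n" for i
    using sq_nth_le_scalar_prod_self[OF assms that] by simp
  with assms show "v = 0\<^sub>v n" by auto
qed (use assms in simp)

lemma scalar_prod_self_nonneg: "0 \<le> (v :: real vec) \<bullet> v"
  by (simp add: scalar_prod_def sum_nonneg)

section \<open>Symmetric quadratic forms and the least eigenvalue\<close>

text \<open>Every product of two coordinates is at most \<open>v \<bullet> v\<close> in absolute
  value, so the absolute entries of \<open>M\<close> add up to a bound. It is applied to an inverse
  matrix for coercivity, and to \<open>M\<close> itself to obtain some lower constant for its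
  form.\<close>

lemma quadratic_form_bounded:
  fixes M :: "real mat"
  assumes M: "M \<in> carrier_mat n n"
  obtains C where "0 < C" "\<And>v. v \<in> carrier_vec n \<Longrightarrow> \<bar>v \<bullet> (M *\<^sub>v v)\<bar> \<le> C * (v \<bullet> v)"
proof
  define C where "C = (\<Sum>i\<in>{0..<n}. \<Sum>j\<in>{0..<n}. \<bar>M $$ (i, j)\<bar>)"
  have "0 \<le> C" by (simp add: C_def sum_nonneg)
  \<comment> \<open>The sum \<open>C\<close> is 0 for the zero matrix; adding 1 makes the bound
    strictly positive, so that it can be inverted later.\<close>
  then show "0 < C + 1" by simp
  fix v :: "real vec" assume v: "v \<in> carrier_vec n"
  have *: "\<bar>v $ i * v $ j\<bar> \<le> v \<bullet> v" if "i < n" "j < n" for i j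
  proof -
    have "\<bar>v $ i\<bar> \<le> sqrt (v \<bullet> v)" "\<bar>v $ j\<bar> \<le> sqrt (v \<bullet> v)"
      using sq_nth_le_scalar_prod_self[OF v] that by (auto intro: real_le_rsqrt)
    then have "\<bar>v $ i\<bar> * \<bar>v $ j\<bar> \<le> sqrt (v \<bullet> v) * sqrt (v \<bullet> v)"
      by (intro mult_mono) (auto intro: scalar_prod_self_nonneg)
    then show ?thesis by (simp add: abs_mult scalar_prod_self_nonneg)
  qed
  have "v \<bullet> (M *\<^sub>v v) = (\<Sum>i\<in>{0..<n}. \<Sum>j\<in>{0..<n}. M $$ (i, j) * (v $ i * v $ j))"
    using v M by (auto simp: scalar_prod_def sum_distrib_left mult_ac intro!: sum.cong)
  also have "\<bar>\<dots>\<bar> \<le> (\<Sum>i\<in>{0..<n}. \<Sum>j\<in>{0..<n}. \<bar>M $$ (i, j)\<bar> * (v \<bullet> v))"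
  proof (intro order.trans[OF sum_abs] sum_mono)
    fix i j assume "i \<in> {0..<n}" "j \<in> {0..<n}"
    then show "\<bar>M $$ (i, j) * (v $ i * v $ j)\<bar> \<le> \<bar>M $$ (i, j)\<bar> * (v \<bullet> v)"
      using *[of i j] by (simp add: abs_mult mult_left_mono)
  qed
  also have "\<dots> = C * (v \<bullet> v)"
    by (simp add: C_def sum_distrib_right)
  also have "\<dots> \<le> (C + 1) * (v \<bullet> v)"
    by (intro mult_right_mono scalar_prod_self_nonneg) simp
  finally show "\<bar>v \<bullet> (M *\<^sub>v v)\<bar> \<le> (C + 1) * (v \<bullet> v)" .
qed

text \<open>Expanding the form at \<open>x - t y\<close> with \<open>B y = x\<close> and \<open>t = 1 / C\<close>, where \<open>C\<close> bounds the form of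
  the inverse of \<open>B\<close>, gives the constant \<open>1 / C\<close>.\<close>

lemma nonsingular_psd_coercive:
  fixes B :: "real mat"
  assumes B: "B \<in> carrier_mat n n" and sym: "B\<^sup>T = B"
    and psd: "\<And>v. v \<in> carrier_vec n \<Longrightarrow> 0 \<le> v \<bullet> (B *\<^sub>v v)"
    and det: "det B \<noteq> 0"
  obtains c where "0 < c" "\<And>v. v \<in> carrier_vec n \<Longrightarrow> c * (v \<bullet> v) \<le> v \<bullet> (B *\<^sub>v v)"
proof -
  from det_non_zero_imp_unit[OF B det, unfolded Units_def, of "()"]
  obtain D where D: "D \<in> carrier_mat n n" and BD: "B * D = 1\<^sub>m n"
    by (auto simp: ring_mat_def)
  obtain C where C: "0 < C" "\<And>v. v \<in> carrier_vec n \<Longrightarrow> \<bar>v \<bullet> (D *\<^sub>v v)\<bar> \<le> C * (v \<bullet> v)"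
    using quadratic_form_bounded[OF D] by blast
  show thesis
  proof
    show "0 < 1 / C" using C by simp
    fix x :: "real vec" assume x: "x \<in> carrier_vec n"
    define y where "y = D *\<^sub>v x"
    have y: "y \<in> carrier_vec n" using D x by (simp add: y_def)
    have By: "B *\<^sub>v y = x"
      using assoc_mult_mat_vec[OF B D x] BD x by (simp add: y_def)
    have Bx: "B *\<^sub>v x \<in> carrier_vec n" using B x by simp
    \<comment> \<open>Symmetry moves \<open>B\<close> onto \<open>y\<close>, where it returns
      \<open>x\<close>. Hence both cross terms of the expansion below are multiples of
      \<open>x \<bullet> x\<close>.\<close>
    have yBx: "y \<bullet> (B *\<^sub>v x) = x \<bullet> x"
      using transpose_vec_mult_scalar[OF B x y] comm_scalar_prod[OF Bx y] sym By by simp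
    have yx: "y \<bullet> x \<le> C * (x \<bullet> x)"
      using C(2)[OF x] comm_scalar_prod[OF x y] by (simp add: y_def)
    let ?t = "1 / C"
    let ?w = "x - ?t \<cdot>\<^sub>v y"
    have ty: "?t \<cdot>\<^sub>v y \<in> carrier_vec n" using y by simp
    have Bw: "B *\<^sub>v ?w = B *\<^sub>v x - ?t \<cdot>\<^sub>v x"
      using mult_minus_distrib_mat_vec[OF B x ty] mult_mat_vec[OF B y] By by simp
    have "?w \<bullet> (B *\<^sub>v ?w) = x \<bullet> (B *\<^sub>v x) - 2 * ?t * (x \<bullet> x) + ?t\<^sup>2 * (y \<bullet> x)"
      unfolding Bw using x y Bx ty yBx
      by (simp add: minus_scalar_prod_distrib[of _ n] scalar_prod_minus_distrib[of _ n]
          power2_eq_square algebra_simps)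
    also have "\<dots> \<le> x \<bullet> (B *\<^sub>v x) - 2 * ?t * (x \<bullet> x) + ?t\<^sup>2 * (C * (x \<bullet> x))"
      using yx by (simp add: mult_left_mono)
    \<comment> \<open>Since \<open>?t\<^sup>2 * C = ?t\<close>, the last term cancels one of the two
      copies of \<open>?t * (x \<bullet> x)\<close>; the other one is the gain, as the form is
      nonnegative at \<open>?w\<close>.\<close>
    also have "\<dots> = x \<bullet> (B *\<^sub>v x) - ?t * (x \<bullet> x)"
      using C(1) by (simp add: power2_eq_square field_simps)
    finally show "1 / C * (x \<bullet> x) \<le> x \<bullet> (B *\<^sub>v x)"
      using psd[of ?w] x y by simp
  qed
qed

text \<open>The best constant \<open>m\<close> in the lower bound is an eigenvalue: otherwise \<open>M - m I\<close> would be coercive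
  and \<open>m\<close> could be increased. No compactness of the unit sphere is needed.\<close>

lemma symmetric_eigenvalue_le_quadratic_form:
  fixes M :: "real mat"
  assumes M: "M \<in> carrier_mat n n" and sym: "M\<^sup>T = M" and n: "0 < n"
  obtains m where "eigenvalue M m"
    "\<And>v. v \<in> carrier_vec n \<Longrightarrow> m * (v \<bullet> v) \<le> v \<bullet> (M *\<^sub>v v)"
proof -
  define S where "S = {c. \<forall>v\<in>carrier_vec n. c * (v \<bullet> v) \<le> v \<bullet> (M *\<^sub>v v)}"
  obtain C where C: "0 < C" "\<And>v. v \<in> carrier_vec n \<Longrightarrow> \<bar>v \<bullet> (M *\<^sub>v v)\<bar> \<le> C * (v \<bullet> v)"
    using quadratic_form_bounded[OF M] by blast
  have "- C \<in> S"
    unfolding S_def using C(2) by (auto simp: abs_le_iff minus_le_iff)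
  then have ne: "S \<noteq> {}" by blast
  \<comment> \<open>The first unit vector, available because \<open>0 < n\<close>, has scalar square
    1, so its form value bounds all of \<open>S\<close>.\<close>
  have bdd: "bdd_above S"
  proof
    fix c assume "c \<in> S"
    then have "c * (unit_vec n 0 \<bullet> unit_vec n 0) \<le> unit_vec n 0 \<bullet> (M *\<^sub>v unit_vec n 0)"
      by (simp add: S_def)
    then show "c \<le> unit_vec n 0 \<bullet> (M *\<^sub>v unit_vec n 0)" using n by simp
  qed
  define m where "m = Sup S"
  have m: "m * (v \<bullet> v) \<le> v \<bullet> (M *\<^sub>v v)" if v: "v \<in> carrier_vec n" for v
  proof (cases "v \<bullet> v = 0")
    case True
    with v M show ?thesis by (simp add: scalar_prod_self_eq_0_iff[OF v])
  next
    case False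
    with scalar_prod_self_nonneg[of v] have pos: "0 < v \<bullet> v" by simp
    \<comment> \<open>The Rayleigh quotient of \<open>v\<close> is an upper bound of
      \<open>S\<close>; thus the supremum is itself an admissible constant.\<close>
    have "m \<le> v \<bullet> (M *\<^sub>v v) / (v \<bullet> v)"
      unfolding m_def using v pos by (intro cSup_least ne) (simp add: S_def pos_le_divide_eq)
    with pos show ?thesis by (simp add: pos_le_divide_eq)
  qed
  \<comment> \<open>This is M - m I. Its form is nonnegative by the choice of \<open>m\<close>, and
    its determinant vanishes exactly when \<open>m\<close> is an eigenvalue.\<close>
  define B where "B = char_matrix M m"
  have B: "B \<in> carrier_mat n n" using M by (simp add: B_def)
  have qB: "v \<bullet> (B *\<^sub>v v) = v \<bullet> (M *\<^sub>v v) - m * (v \<bullet> v)" if v: "v \<in> carrier_vec n" for v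
  proof -
    have "B *\<^sub>v v = M *\<^sub>v v + (- m) \<cdot>\<^sub>v v"
      unfolding B_def char_matrix_def using M v
      by (auto simp: add_mult_distrib_mat_vec[of _ n n] intro!: eq_vecI)
    then show ?thesis
      using M v by (simp add: scalar_prod_add_distrib[of _ n])
  qed
  have "det B = 0"
  proof (rule ccontr)
    assume det: "det B \<noteq> 0"
    have "B\<^sup>T = B"
    proof (rule eq_matI)
      fix i j assume "i < dim_row B" "j < dim_col B"
      then have ij: "i < n" "j < n" using B by auto
      have "M $$ (j, i) = M\<^sup>T $$ (i, j)" using M ij by simp
      then have "M $$ (j, i) = M $$ (i, j)" using sym by simp
      then show "B\<^sup>T $$ (i, j) = B $$ (i, j)"
        using M ij by (simp add: B_def char_matrix_def)
    qed (use B in auto)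
    from nonsingular_psd_coercive[OF B this _ det] m qB
    obtain c where c: "0 < c" "\<And>v. v \<in> carrier_vec n \<Longrightarrow> c * (v \<bullet> v) \<le> v \<bullet> (B *\<^sub>v v)"
      by (metis diff_ge_0_iff_ge)
    have "m + c \<in> S"
      unfolding S_def using c(2) qB by (force simp: algebra_simps)
    then have "m + c \<le> m" unfolding m_def by (intro cSup_upper bdd)
    with c(1) show False by simp
  qed
  then have "eigenvalue M m" by (simp add: eigenvalue_det[OF M] B_def)
  with m show thesis by (rule that[rotated -1])
qed

lemma Min_spectrum_le_quadratic_form:
  fixes M :: "real mat"
  assumes M: "M \<in> carrier_mat n n" and sym: "M\<^sup>T = M" and v: "v \<in> carrier_vec n"
  shows "Min (spectrum M) * (v \<bullet> v) \<le> v \<bullet> (M *\<^sub>v v)"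
\<comment> \<open>For \<open>n = 0\<close> the spectrum is empty and its \<open>Min\<close>
  unspecified, but the scalar products on both sides are empty sums.\<close>
proof (cases "n = 0")
  case True
  with v M show ?thesis by (simp add: scalar_prod_def)
next
  case False
  then obtain m where m: "eigenvalue M m"
    "\<And>v. v \<in> carrier_vec n \<Longrightarrow> m * (v \<bullet> v) \<le> v \<bullet> (M *\<^sub>v v)"
    using symmetric_eigenvalue_le_quadratic_form[OF M sym] by blast
  have "Min (spectrum M) \<le> m"
    using m(1) card_finite_spectrum(1)[OF M] by (simp add: spectrum_def)
  then have "Min (spectrum M) * (v \<bullet> v) \<le> m * (v \<bullet> v)"
    by (intro mult_right_mono scalar_prod_self_nonneg)
  also have "\<dots> \<le> v \<bullet> (M *\<^sub>v v)" by (rule m(2)[OF v])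
  finally show ?thesis .
qed

section \<open>Coercivity of the fidelity term\<close>

lemma euclidean_norm_sq: "(euclidean_norm v)\<^sup>2 = v \<bullet> v"
  by (simp add: euclidean_norm_def L2_set_def sum_nonneg scalar_prod_def power2_eq_square)

text \<open>The squared norm of the image is the quadratic form of the symmetric matrix
  \<open>A\<^sup>T * A\<close>, to which the eigenvalue bound applies.\<close>

lemma Min_spectrum_le_euclidean_norm_mult:
  fixes A :: "real mat"
  assumes A: "A \<in> carrier_mat K N" and v: "v \<in> carrier_vec N"
  shows "Min (spectrum (A\<^sup>T * A)) * (v \<bullet> v) \<le> (euclidean_norm (A *\<^sub>v v))\<^sup>2"
proof -
  have "(A\<^sup>T * A)\<^sup>T = A\<^sup>T * A"
    using transpose_mult[of "A\<^sup>T" N K A N] A by simp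
  then have "Min (spectrum (A\<^sup>T * A)) * (v \<bullet> v) \<le> v \<bullet> ((A\<^sup>T * A) *\<^sub>v v)"
    using A v by (intro Min_spectrum_le_quadratic_form[of _ N]) auto
  also have "v \<bullet> ((A\<^sup>T * A) *\<^sub>v v) = (A *\<^sub>v v) \<bullet> (A *\<^sub>v v)"
  proof -
    have c: "A *\<^sub>v v \<in> carrier_vec K" using A v by simp
    have "(A\<^sup>T * A) *\<^sub>v v = A\<^sup>T *\<^sub>v (A *\<^sub>v v)"
      using A v by (intro assoc_mult_mat_vec[of _ N K]) auto
    moreover have "(A\<^sup>T *\<^sub>v (A *\<^sub>v v)) \<bullet> v = (A *\<^sub>v v) \<bullet> (A *\<^sub>v v)"
      using transpose_vec_mult_scalar[OF A v c] A v c
      by (metis comm_scalar_prod mult_mat_vec_carrier transpose_carrier_mat)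
    ultimately show ?thesis
      using A v c by (metis comm_scalar_prod mult_mat_vec_carrier transpose_carrier_mat)
  qed
  finally show ?thesis by (simp add: euclidean_norm_sq)
qed

section \<open>Forward differences and the truncated penalty\<close>

lemma forward_diff_add:
  assumes "u \<in> carrier_vec N" "v \<in> carrier_vec N" "i < N"
  shows "forward_diff bc (u + v) $ i = forward_diff bc u $ i + forward_diff bc v $ i"
  using assms by (auto simp: forward_diff_def split: boundary_condition.split)

lemma forward_diff_smult:
  assumes "u \<in> carrier_vec N" "i < N"
  shows "forward_diff bc (c \<cdot>\<^sub>v u) $ i = c * forward_diff bc u $ i"
  using assms by (auto simp: forward_diff_def algebra_simps split: boundary_condition.split)

text \<open>Interior and periodic differences subtract two coordinates and the Neumann one is 0, so
  a single constant serves both boundary conditions.\<close>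

lemma forward_diff_sq_le:
  assumes "v \<in> carrier_vec N" "i < N"
  shows "(forward_diff bc v $ i)\<^sup>2 \<le> 2 * (v \<bullet> v)"
  using assms sq_nth_diff_le_scalar_prod_self[of v N i "Suc i"]
    sq_nth_diff_le_scalar_prod_self[of v N i 0] scalar_prod_self_nonneg[of v]
  by (auto simp: forward_diff_def split: boundary_condition.split)

text \<open>Entries are 0 or 1, so a nonzero difference is 1 or -1: after scaling, all jumps have
  height \<zeta>.\<close>

lemma abs_forward_diff_indicator_vec:
  assumes "i < N"
  shows "\<bar>forward_diff bc (indicator_vec N \<Omega>) $ i\<bar> = (if i \<in> jump_set bc N \<Omega> then 1 else 0)"
  using assms
  by (auto simp: jump_set_def forward_diff_def indicator_vec_def indicator_def
      split: boundary_condition.splits if_splits)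

lemma truncation_eq: "\<tau> \<le> s \<Longrightarrow> truncation \<rho> \<tau> s = truncation \<rho> \<tau> \<tau>"
  by (simp add: truncation_def)

lemma truncation_nonneg:
  assumes "AS1 \<rho>" "0 < \<tau>" "0 \<le> s"
  shows "0 \<le> truncation \<rho> \<tau> s"
  using assms by (cases "min s \<tau> = 0") (auto simp: truncation_def AS1_def less_imp_le min_def)

section \<open>Minimality and uniqueness of the scaled indicator\<close>

theorem theorem6p1:
  fixes \<rho> :: "real \<Rightarrow> real" and \<tau> \<alpha> \<zeta> \<mu>_min :: real
    and K N :: nat and \<Omega> :: "nat set" and A :: "real mat"
    and bc :: boundary_condition
  assumes "AS1 \<rho>" and "AS2 \<rho>"
    and "0 < \<tau>"
    and "\<Omega> \<noteq> {}" and "\<Omega> \<subset> {0..<N}"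
    and "0 < \<alpha>" and "0 < \<zeta>"
    and "A \<in> carrier_mat K N"
    and "invertible_mat (A\<^sup>T * A)"
    and "\<mu>_min = Min (spectrum (A\<^sup>T * A))" and "0 < \<mu>_min"
    and "\<zeta> > \<tau> + sqrt (4 * truncation \<rho> \<tau> \<tau> / (\<alpha> * \<mu>_min) * real (card (jump_set bc N \<Omega>)))"
  shows "{u. is_arg_min (energy bc \<rho> \<tau> \<alpha> A N \<Omega> \<zeta>) (\<lambda>u. u \<in> carrier_vec N) u}
           = {\<zeta> \<cdot>\<^sub>v indicator_vec N \<Omega>}"
proof -
  let ?E = "energy bc \<rho> \<tau> \<alpha> A N \<Omega> \<zeta>" and ?T = "truncation \<rho> \<tau>" and ?J = "jump_set bc N \<Omega>"
  define w where "w = \<zeta> \<cdot>\<^sub>v indicator_vec N \<Omega>"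
  define R where "R = 4 * ?T \<tau> / (\<alpha> * \<mu>_min) * real (card ?J)"
  have \<zeta>: "\<tau> + sqrt R < \<zeta>" using assms(12) by (simp add: R_def)
  have T\<tau>: "0 \<le> ?T \<tau>" using truncation_nonneg[OF assms(1,3), of \<tau>] \<open>0 < \<tau>\<close> by simp
  have R: "0 \<le> R" using T\<tau> \<open>0 < \<alpha>\<close> \<open>0 < \<mu>_min\<close> by (simp add: R_def)
  have J: "?J \<subseteq> {0..<N}" by (auto simp: jump_set_def)
  have ind: "indicator_vec N \<Omega> \<in> carrier_vec N" by (simp add: indicator_vec_def)
  then have w: "w \<in> carrier_vec N" by (simp add: w_def)
  have Dw: "\<bar>forward_diff bc w $ i\<bar> = (if i \<in> ?J then \<zeta> else 0)" if "i < N" for i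
    using forward_diff_smult[OF ind that, of bc \<zeta>] abs_forward_diff_indicator_vec[OF that, of bc \<Omega>]
      \<open>0 < \<zeta>\<close> by (auto simp: w_def abs_mult)
  have T0: "?T 0 = 0" using assms(1,3) by (simp add: truncation_def AS1_def)
  have "\<tau> \<le> \<zeta>" using \<zeta> R by (smt (verit) real_sqrt_ge_zero)
  have "(\<Sum>i\<in>{0..<N}. ?T \<bar>forward_diff bc w $ i\<bar>) = (\<Sum>i\<in>{0..<N}. if i \<in> ?J then ?T \<tau> else 0)"
    using truncation_eq[OF \<open>\<tau> \<le> \<zeta>\<close>, of \<rho>] by (intro sum.cong) (auto simp: Dw T0)
  also have "\<dots> = real (card ?J) * ?T \<tau>"
    using J by (simp add: sum.If_cases Int_absorb1)
  finally have Ew: "?E w = real (card ?J) * ?T \<tau>"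
    using assms(8) w
    by (simp add: energy_def w_def[symmetric] euclidean_norm_sq scalar_prod_def)
  \<comment> \<open>This gives both halves of the claim: no vector has energy below that of
    \<open>w\<close>, and any minimizer, having energy at most \<open>?E w\<close>, is
    \<open>w\<close>.\<close>
  have key: "u = w" if u: "u \<in> carrier_vec N" and le: "?E u \<le> ?E w" for u
  proof -
    define d where "d = u - w"
    have d: "d \<in> carrier_vec N" using u w by (simp add: d_def)
    have u_eq: "u = w + d" using u w by (auto simp: d_def)
    define F where "F = \<alpha> / 2 * (euclidean_norm (A *\<^sub>v d))\<^sup>2"
    have Eu: "?E u = (\<Sum>i\<in>{0..<N}. ?T \<bar>forward_diff bc u $ i\<bar>) + F"
      by (simp add: energy_def F_def d_def w_def)
    have sub: "(\<Sum>i\<in>?J. ?T \<bar>forward_diff bc u $ i\<bar>) \<le> (\<Sum>i\<in>{0..<N}. ?T \<bar>forward_diff bc u $ i\<bar>)"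
      using J by (intro sum_mono2) (auto intro: truncation_nonneg[OF assms(1,3)])
    have pos: "0 \<le> (\<Sum>i\<in>{0..<N}. ?T \<bar>forward_diff bc u $ i\<bar>)"
      by (intro sum_nonneg truncation_nonneg[OF assms(1,3)]) simp
    \<comment> \<open>This estimate is used twice: first with the regularizer merely nonnegative, to
      make \<open>d\<close> small, then with the regularizer at least \<open>?E w\<close>, to make
      \<open>d\<close> vanish.\<close>
    have coercive: "\<alpha> / 2 * (\<mu>_min * (d \<bullet> d)) \<le> F"
      unfolding F_def assms(10)
      using Min_spectrum_le_euclidean_norm_mult[OF assms(8) d] \<open>0 < \<alpha>\<close>
      by (intro mult_left_mono) auto
    with pos le Eu Ew have "\<alpha> / 2 * (\<mu>_min * (d \<bullet> d)) \<le> real (card ?J) * ?T \<tau>" by linarith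
    \<comment> \<open>Solving for \<open>d \<bullet> d\<close> gives the constant 2 in place of the
      4 in \<open>R\<close>; doubling matches the bound on squared forward differences of
      \<open>d\<close>.\<close>
    then have dR: "2 * (d \<bullet> d) \<le> R"
      using \<open>0 < \<alpha>\<close> \<open>0 < \<mu>_min\<close> by (simp add: R_def field_simps)
    have "?T \<bar>forward_diff bc u $ i\<bar> = ?T \<tau>" if i: "i \<in> ?J" for i
    proof (rule truncation_eq)
      from i J have iN: "i < N" by auto
      have "\<bar>forward_diff bc d $ i\<bar> \<le> sqrt R"
        using forward_diff_sq_le[OF d iN, of bc] dR by (intro real_le_rsqrt) simp
      moreover have "\<bar>forward_diff bc w $ i\<bar> = \<zeta>" using Dw[OF iN] i by simp
      ultimately show "\<tau> \<le> \<bar>forward_diff bc u $ i\<bar>"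
        using \<zeta> forward_diff_add[OF w d iN, of bc] unfolding u_eq by linarith
    qed
    with sub have "real (card ?J) * ?T \<tau> \<le> (\<Sum>i\<in>{0..<N}. ?T \<bar>forward_diff bc u $ i\<bar>)"
      by simp
    with le Eu Ew coercive have "\<alpha> / 2 * (\<mu>_min * (d \<bullet> d)) \<le> 0" by linarith
    then have "d \<bullet> d \<le> 0"
      using \<open>0 < \<alpha>\<close> \<open>0 < \<mu>_min\<close> by (simp add: mult_le_0_iff)
    then have "d = 0\<^sub>v N"
      using scalar_prod_self_nonneg[of d] scalar_prod_self_eq_0_iff[OF d] by simp
    then show "u = w" using u_eq w by simp
  qed
  show ?thesis
    unfolding w_def[symmetric] is_arg_min_def
    using key w by (auto simp: not_less) (metis less_le not_le)+
qed

end
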